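(* For every nonempty signed graph $\Sigma$, $$\overline{\vartheta}_{\mathrm b}(\Sigma)=\tfrac12\,\overline{\vartheta}(C(\Sigma)),$$ where $C(\Sigma)$ is the conflict graph of $\Sigma$.
   Context: Signed graphs. A signed graph is a pair $\Sigma=(G,\sigma)$ with $G$ a finite graph and $\sigma:E(G)\to\{+1,-1\}$. Positive loops are allowed, negative loops are excluded; between two distinct vertices there may be both a positive and a negative edge (a digon); repeated edges of the same sign are immaterial. Convention: every signed graph is replaced by its completion having a positive loop at every vertex. Signed homomorphism. A signed homomorphism $\Sigma\to\Pi$ consists of a switching function $\tau:V(\Sigma)\to\{\pm1\}$ and a vertex map $f:V(\Sigma)\to V(\Pi)$ such that for every edge $e=uv$ of $\Sigma$ the signed graph $\Pi$ contains an edge between $f(u)$ and $f(v)$ of sign $\tau(u)\sigma(e)\tau(v)$. Signed sphere. Let $\mathcal H=\mathcal H_+\oplus\mathcal H_-$ be a finite-dimensional real inner-product space (orthogonal direct sum) and $R(a,b)=(a,-b)$. For $t\ge1$ put $\gamma_t=\frac1{1-2t}$. The (infinite) signed graph $\mathcal S_t(\mathcal H,R)$ has vertex set $\{x\in\mathcal H:\|x\|=1,\ \langle x,Rx\rangle=\gamma_t\}$; $x,y$ are joined by a negative edge iff $\langle x,y\rangle=\gamma_t$, and by a positive edge iff $\langle x,Ry\rangle=\gamma_t$ (both may hold; $x=y$ allowed). Balanced theta parameter. For nonempty $\Sigma$ (with positive loops adjoined), $\overline{\vartheta}_{\mathrm b}(\Sigma)=\inf\{t\ge1:\text{there is a signed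 homomorphism }\Sigma\to\mathcal S_t(\mathcal H,R)\text{ for some finite-dimensional }\mathcal H=\mathcal H_+\oplus\mathcal H_-\}$. Conflict graph. $C(\Sigma)$ is the ordinary simple graph on $V(\Sigma)\times\{\pm1\}$ with $(u,s)\sim(v,r)$ iff there is an edge $e=uv$ of $\Sigma$ (possibly a loop, $u=v$) with $r=-\sigma(e)s$. In particular $(v,+)\sim(v,-)$ for all $v$ because of the positive loops. Ordinary theta. For a nonempty finite simple graph $H$, $\overline{\vartheta}(H)=\vartheta(\overline H)$ is the Lovász theta number of the complement; equivalently, it is the minimum $\lambda\in\mathbb R$ such that there is a real symmetric $M\succeq0$ indexed by $V(H)$ with $M_{vv}=\lambda-1$ for all $v$ and $M_{uv}=-1$ for all $uv\in E(H)$. *)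

theory Defs
  imports Complex_Main "Jordan_Normal_Form.Matrix"
begin

(* A signed edge is a pair (e, s) of an unordered pair of vertices e = {u, v} (a singleton for a
   loop) and a sign s = 1 or s = -1, so a digon is two signed edges on the same e and repeated
   edges of equal sign are identified. The vertex set may be infinite. *)

record 'a sgraph =
  sverts :: "'a set"
  sedges :: "('a set \<times> int) set"

locale signed_graph =
  fixes S :: "'a sgraph"
  assumes edge_ends: "(e, s) \<in> sedges S \<Longrightarrow> \<exists>u\<in>sverts S. \<exists>v\<in>sverts S. e = {u, v}"
    and edge_sign: "(e, s) \<in> sedges S \<Longrightarrow> s = 1 \<or> s = - 1"
    and no_negative_loop: "({v}, - 1) \<notin> sedges S"

locale finite_signed_graph = signed_graph +
  assumes finite_verts: "finite (sverts S)"

definition completion :: "'a sgraph \<Rightarrow> 'a sgraph" where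
  "completion S = S\<lparr>sedges := sedges S \<union> (\<lambda>v. ({v}, 1)) ` sverts S\<rparr>"

definition signed_hom :: "'a sgraph \<Rightarrow> 'b sgraph \<Rightarrow> ('a \<Rightarrow> int) \<Rightarrow> ('a \<Rightarrow> 'b) \<Rightarrow> bool" where
  "signed_hom S P \<tau> f \<longleftrightarrow>
     (\<forall>v\<in>sverts S. \<tau> v = 1 \<or> \<tau> v = - 1) \<and>
     (\<forall>v\<in>sverts S. f v \<in> sverts P) \<and>
     (\<forall>u v s. ({u, v}, s) \<in> sedges S \<longrightarrow> ({f u, f v}, \<tau> u * s * \<tau> v) \<in> sedges P)"

(* Types cannot be quantified existentially, so a finite-dimensional inner product space with an
   orthogonal decomposition H+ (+) H- is taken in orthonormal coordinates: H+ is R^p and H- is R^q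
   (p, q >= 0, zero summands allowed), and an element of H is a pair (a, b). *)

type_synonym hvec = "real vec \<times> real vec"

definition hspace :: "nat \<Rightarrow> nat \<Rightarrow> hvec set" where
  "hspace p q = carrier_vec p \<times> carrier_vec q"

definition hinner :: "hvec \<Rightarrow> hvec \<Rightarrow> real" where
  "hinner x y = fst x \<bullet> fst y + snd x \<bullet> snd y"

definition hnorm :: "hvec \<Rightarrow> real" where
  "hnorm x = sqrt (hinner x x)"

definition hrefl :: "hvec \<Rightarrow> hvec" where
  "hrefl x = (fst x, - snd x)"

definition gam :: "real \<Rightarrow> real" where
  "gam t = 1 / (1 - 2 * t)"

definition sphere_verts :: "nat \<Rightarrow> nat \<Rightarrow> real \<Rightarrow> hvec set" where
  "sphere_verts p q t = {x \<in> hspace p q. hnorm x = 1 \<and> hinner x (hrefl x) = gam t}"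

definition signed_sphere :: "nat \<Rightarrow> nat \<Rightarrow> real \<Rightarrow> hvec sgraph" where
  "signed_sphere p q t =
     \<lparr>sverts = sphere_verts p q t,
      sedges =
        {({x, y}, - 1) | x y. x \<in> sphere_verts p q t \<and> y \<in> sphere_verts p q t \<and> hinner x y = gam t}
      \<union> {({x, y}, 1) | x y. x \<in> sphere_verts p q t \<and> y \<in> sphere_verts p q t \<and>
                            hinner x (hrefl y) = gam t}\<rparr>"

definition balanced_theta :: "'a sgraph \<Rightarrow> real" where
  "balanced_theta S =
     Inf {t. t \<ge> 1 \<and> (\<exists>p q \<tau> f. signed_hom (completion S) (signed_sphere p q t) \<tau> f)}"

record 'a graph =
  gverts :: "'a set"
  gedges :: "'a set set"

locale simple_graph =
  fixes H :: "'a graph"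
  assumes edge_two_ends: "e \<in> gedges H \<Longrightarrow> \<exists>u\<in>gverts H. \<exists>v\<in>gverts H. u \<noteq> v \<and> e = {u, v}"

definition psd_on :: "'a set \<Rightarrow> ('a \<Rightarrow> 'a \<Rightarrow> real) \<Rightarrow> bool" where
  "psd_on V M \<longleftrightarrow>
     (\<forall>u\<in>V. \<forall>v\<in>V. M u v = M v u) \<and>
     (\<forall>x :: 'a \<Rightarrow> real. (\<Sum>u\<in>V. \<Sum>v\<in>V. x u * M u v * x v) \<ge> 0)"

(* The Lovasz theta number of the complement of H; for finite nonempty H the infimum is attained. *)

definition theta_bar :: "'a graph \<Rightarrow> real" where
  "theta_bar H =
     Inf {l. \<exists>M. psd_on (gverts H) M \<and> (\<forall>v\<in>gverts H. M v v = l - 1) \<and>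
                 (\<forall>u v. {u, v} \<in> gedges H \<longrightarrow> M u v = - 1)}"

definition conflict_graph :: "'a sgraph \<Rightarrow> ('a \<times> int) graph" where
  "conflict_graph S =
     \<lparr>gverts = sverts S \<times> {1, - 1},
      gedges = {{(u, s), (v, r)} | u s v r. s \<in> {1, - 1} \<and> r \<in> {1, - 1} \<and>
                  (\<exists>\<sigma>. ({u, v}, \<sigma>) \<in> sedges (completion S) \<and> r = - \<sigma> * s)}\<rparr>"

lemma finite_signed_graph_completion:
  assumes "finite_signed_graph S" shows "finite_signed_graph (completion S)"
proof -
  interpret finite_signed_graph S by fact
  show ?thesis
  proof
    fix e s assume "(e, s) \<in> sedges (completion S)"
    then show "\<exists>u\<in>sverts (completion S). \<exists>v\<in>sverts (completion S). e = {u, v}"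
      using edge_ends by (fastforce simp: completion_def)
  qed (use edge_sign no_negative_loop finite_verts in \<open>auto simp: completion_def\<close>)
qed

lemma signed_graph_sphere:
  assumes "t \<ge> 1" shows "signed_graph (signed_sphere p q t)"
proof
  fix x
  have "gam t < 0" using assms by (simp add: gam_def)
  then show "({x}, - 1) \<notin> sedges (signed_sphere p q t)"
    by (auto simp: signed_sphere_def sphere_verts_def hnorm_def singleton_insert_inj_eq')
qed (auto simp: signed_sphere_def)

lemma completion_signed_sphere: "completion (signed_sphere p q t) = signed_sphere p q t"
  unfolding completion_def signed_sphere_def by (auto simp: sphere_verts_def)

lemma hinner_hrefl:
  assumes "x \<in> hspace p q" "y \<in> hspace p q"
  shows "hinner x (hrefl y) = fst x \<bullet> fst y - snd x \<bullet> snd y"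
  using assms by (auto simp: hspace_def hinner_def hrefl_def)

lemma signed_sphere_edge_iff:
  assumes "x \<in> sphere_verts p q t" "y \<in> sphere_verts p q t"
  shows "({x, y}, - 1) \<in> sedges (signed_sphere p q t) \<longleftrightarrow> hinner x y = gam t"
    and "({x, y}, 1) \<in> sedges (signed_sphere p q t) \<longleftrightarrow> hinner x (hrefl y) = gam t"
proof -
  have mem: "x \<in> hspace p q" "y \<in> hspace p q" using assms by (auto simp: sphere_verts_def)
  have c: "fst x \<bullet> fst y = fst y \<bullet> fst x" "snd x \<bullet> snd y = snd y \<bullet> snd x"
    using mem by (auto simp: hspace_def intro!: comm_scalar_prod)
  have i: "hinner x y = hinner y x" using c by (simp add: hinner_def)
  have j: "hinner x (hrefl y) = hinner y (hrefl x)"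
    using c mem by (simp add: hinner_hrefl)
  show "({x, y}, - 1) \<in> sedges (signed_sphere p q t) \<longleftrightarrow> hinner x y = gam t"
    using assms i by (auto simp: signed_sphere_def doubleton_eq_iff simp del: split_paired_Ex)
  show "({x, y}, 1) \<in> sedges (signed_sphere p q t) \<longleftrightarrow> hinner x (hrefl y) = gam t"
    using assms j by (auto simp: signed_sphere_def doubleton_eq_iff simp del: split_paired_Ex)
qed

lemma simple_graph_conflict_graph:
  assumes "finite_signed_graph S" shows "simple_graph (conflict_graph S)"
proof -
  interpret finite_signed_graph "completion S"
    using assms by (rule finite_signed_graph_completion)
  have V: "sverts (completion S) = sverts S" by (simp add: completion_def)
  show ?thesis
  proof
    fix e assume "e \<in> gedges (conflict_graph S)"
    then obtain u s v r \<sigma> where e: "e = {(u, s), (v, r)}" "s \<in> {1, - 1}" "r \<in> {1, - 1}"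
      "({u, v}, \<sigma>) \<in> sedges (completion S)" "r = - \<sigma> * s"
      unfolding conflict_graph_def graph.simps by blast
    have "u \<in> sverts S" "v \<in> sverts S"
      using edge_ends[OF e(4)] by (auto simp: V doubleton_eq_iff)
    moreover have "(u, s) \<noteq> (v, r)"
    proof
      assume "(u, s) = (v, r)"
      then show False using e edge_sign[OF e(4)] no_negative_loop[of u] by auto
    qed
    ultimately show "\<exists>a\<in>gverts (conflict_graph S). \<exists>b\<in>gverts (conflict_graph S). a \<noteq> b \<and> e = {a, b}"
      using e(1-3) by (intro bexI[of _ "(u, s)"] bexI[of _ "(v, r)"]) (auto simp: conflict_graph_def)
  qed
qed

end

theory Submission
  imports Defs
begin

text \<open>
  After averaging over the sign flip (u, s) \<mapsto> (u, -s), a feasible matrix on the conflict graph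
  is a 2 x 2 block matrix with blocks P, Q, Q, P, so it is determined by the positive semidefinite
  matrices P + Q and P - Q. Their Gram vectors are the components in H+ and H- of a map
  into the sphere, P and Q becoming the matrices of \<langle>x, y\<rangle> and \<langle>x, R y\<rangle>. Conversely, the vectors
  x and R x attached to (u, 1) and (u, -1), permuted by the switching, have a feasible Gram matrix.
  The parameters correspond by l = 2 t, as (l - 1) \<gamma> = -1.
\<close>

subsection \<open>Gram representation of positive semidefinite matrices\<close>

text \<open>The discriminant condition, with the degenerate case included: for \<open>c = 0\<close>
  division by zero gives \<open>b\<^sup>2 / c = 0\<close>, so the last claim then says
  \<open>d \<ge> 0\<close>.\<close>

lemma nonneg_quadratic:
  fixes b c d :: real
  assumes "\<And>t. c * t\<^sup>2 + 2 * b * t + d \<ge> 0"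
  shows "c \<ge> 0" and "c = 0 \<Longrightarrow> b = 0" and "b\<^sup>2 / c \<le> d"
proof -
  have d: "d \<ge> 0" using assms[of 0] by simp
  show b: "b = 0" if "c = 0"
  proof (rule ccontr)
    assume "b \<noteq> 0"
    \<comment> \<open>At this point the linear polynomial takes the value -1.\<close>
    then show False using assms[of "- (d + 1) / (2 * b)"] that by (simp add: field_simps)
  qed
  show c: "c \<ge> 0"
  proof (rule ccontr)
    assume "\<not> c \<ge> 0"
    then have neg: "c < 0" by simp
    \<comment> \<open>Chosen so that \<open>c * t + 2 * b \<le> - 1\<close> and
      \<open>t > d\<close>; the polynomial is then at most \<open>d - t < 0\<close>.\<close>
    define t where "t = 1 + d - (2 * \<bar>b\<bar> + 1) / c"
    have "c * t = c * (1 + d) - (2 * \<bar>b\<bar> + 1)" using neg by (simp add: t_def field_simps)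
    moreover have "c * (1 + d) \<le> 0" using neg d by (simp add: mult_nonpos_nonneg)
    ultimately have "c * t + 2 * b \<le> - 1" by linarith
    moreover have "(2 * \<bar>b\<bar> + 1) / c \<le> 0" using neg by (intro divide_nonneg_neg) auto
    then have t: "t > d" by (simp add: t_def)
    ultimately have "(c * t + 2 * b) * t \<le> - 1 * t" using d t by (intro mult_right_mono) auto
    then show False using assms[of t] t by (simp add: power2_eq_square algebra_simps)
  qed
  show "b\<^sup>2 / c \<le> d"
  proof (cases "c = 0")
    case False
    have "c * (- b / c)\<^sup>2 + 2 * b * (- b / c) + d = d - b\<^sup>2 / c"
      using False by (simp add: power2_eq_square field_simps)
    then show ?thesis using assms[of "- b / c"] by simp
  qed (use d in simp)
qed

text \<open>Isolates the variable \<open>x w\<close>, in which the form is a quadratic polynomial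
  accessible to \<open>nonneg_quadratic\<close>.\<close>

lemma quadratic_form_insert:
  fixes M :: "'a \<Rightarrow> 'a \<Rightarrow> real"
  assumes "finite W" "w \<notin> W" and sym: "\<And>v. v \<in> W \<Longrightarrow> M v w = M w v"
  shows "(\<Sum>u\<in>insert w W. \<Sum>v\<in>insert w W. x u * M u v * x v) =
    M w w * (x w)\<^sup>2 + 2 * (\<Sum>v\<in>W. M w v * x v) * x w + (\<Sum>u\<in>W. \<Sum>v\<in>W. x u * M u v * x v)"
proof -
  have 1: "(\<Sum>v\<in>W. x w * M w v * x v) = (\<Sum>v\<in>W. M w v * x v) * x w"
    unfolding sum_distrib_right by (simp add: mult_ac)
  have 2: "(\<Sum>v\<in>W. x v * M v w * x w) = (\<Sum>v\<in>W. M w v * x v) * x w"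
    unfolding sum_distrib_right by (rule sum.cong) (auto simp: sym)
  show ?thesis
    using assms(1,2) by (simp add: sum.distrib 1 2 power2_eq_square)
qed

text \<open>Cholesky factorisation: eliminate the pivot \<open>w\<close>, factor the Schur
  complement on \<open>W\<close> by induction, and restore the removed rank-one part with one extra
  coordinate.\<close>

lemma psd_on_gram:
  assumes "finite V" "psd_on V M"
  shows "\<exists>a. (\<forall>v\<in>V. a v \<in> carrier_vec (card V)) \<and> (\<forall>u\<in>V. \<forall>v\<in>V. M u v = a u \<bullet> a v)"
  using assms
proof (induction V arbitrary: M)
  case empty
  then show ?case by simp
next
  case (insert w W)
  let ?c = "M w w"
  \<comment> \<open>The Schur complement of the pivot; it equals \<open>M\<close> when the pivot is
    zero.\<close>
  let ?M = "\<lambda>u v. M u v - M w u * M w v / ?c"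
  have sym: "M u v = M v u" if "u \<in> insert w W" "v \<in> insert w W" for u v
    using insert.prems that unfolding psd_on_def by blast
  have quad: "?c * t\<^sup>2 + 2 * (\<Sum>v\<in>W. M w v * x v) * t + (\<Sum>u\<in>W. \<Sum>v\<in>W. x u * M u v * x v) \<ge> 0"
    for x t
  proof -
    let ?x = "x(w := t)"
    have *: "v \<noteq> w" if "v \<in> W" for v using that insert.hyps by auto
    have "(\<Sum>u\<in>insert w W. \<Sum>v\<in>insert w W. ?x u * M u v * ?x v) \<ge> 0"
      using insert.prems unfolding psd_on_def by blast
    moreover have "(\<Sum>v\<in>W. M w v * ?x v) = (\<Sum>v\<in>W. M w v * x v)"
      by (rule sum.cong) (simp_all add: *)
    moreover have "(\<Sum>u\<in>W. \<Sum>v\<in>W. ?x u * M u v * ?x v) = (\<Sum>u\<in>W. \<Sum>v\<in>W. x u * M u v * x v)"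
      by (intro sum.cong refl) (simp add: *)
    ultimately show ?thesis
      by (subst (asm) quadratic_form_insert) (use insert.hyps sym in auto)
  qed
  have "psd_on W ?M"
    unfolding psd_on_def
  proof (intro conjI ballI allI)
    fix u v assume "u \<in> W" "v \<in> W"
    then show "?M u v = ?M v u" using sym by simp
  next
    fix x :: "'a \<Rightarrow> real"
    have "(\<Sum>u\<in>W. \<Sum>v\<in>W. x u * ?M u v * x v) =
      (\<Sum>u\<in>W. \<Sum>v\<in>W. x u * M u v * x v) - (\<Sum>u\<in>W. \<Sum>v\<in>W. (M w u * x u) * (M w v * x v)) / ?c"
      unfolding sum_divide_distrib sum_subtractf[symmetric]
      by (intro sum.cong refl) (simp add: algebra_simps)
    also have "\<dots> = (\<Sum>u\<in>W. \<Sum>v\<in>W. x u * M u v * x v) - (\<Sum>v\<in>W. M w v * x v)\<^sup>2 / ?c"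
      by (simp add: sum_product power2_eq_square)
    also have "\<dots> \<ge> 0" using nonneg_quadratic(3)[OF quad[of _ x]] by simp
    finally show "(\<Sum>u\<in>W. \<Sum>v\<in>W. x u * ?M u v * x v) \<ge> 0" .
  qed
  then obtain a where a: "\<And>v. v \<in> W \<Longrightarrow> a v \<in> carrier_vec (card W)"
    "\<And>u v. u \<in> W \<Longrightarrow> v \<in> W \<Longrightarrow> ?M u v = a u \<bullet> a v"
    using insert.IH by blast
  have c: "?c \<ge> 0" using nonneg_quadratic(1)[OF quad] .
  \<comment> \<open>A zero pivot has a zero row: with the indicator of \<open>v\<close> as test
    vector, the linear coefficient is \<open>M w v\<close>. Hence the quotient by
    \<open>sqrt ?c\<close> in \<open>b\<close> stays correct for \<open>?c = 0\<close>.\<close>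
  have zero: "M w v = 0" if "?c = 0" "v \<in> W" for v
  proof -
    have "(\<Sum>u\<in>W. M w u * of_bool (u = v)) = 0" using nonneg_quadratic(2)[OF quad \<open>?c = 0\<close>] .
    then show ?thesis using that insert.hyps(1) by (simp add: of_bool_def if_distrib cong: if_cong)
  qed
  define b where
    "b v = (if v = w then vCons (sqrt ?c) (0\<^sub>v (card W)) else vCons (M w v / sqrt ?c) (a v))" for v
  have "b v \<in> carrier_vec (card (insert w W))" if "v \<in> insert w W" for v
    using that insert.hyps a(1) by (auto simp: b_def)
  moreover have "M u v = b u \<bullet> b v" if uv: "u \<in> insert w W" "v \<in> insert w W" for u v
  proof -
    have W: "M w v = b w \<bullet> b v" "M w v = b v \<bullet> b w" if "v \<in> W" for v
      using that insert.hyps c zero a(1)[OF that] by (auto simp: b_def)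
    have "M w w = b w \<bullet> b w" using c by (simp add: b_def)
    moreover have "M u v = b u \<bullet> b v" if "u \<in> W" "v \<in> W"
      using that insert.hyps c a(2)[OF that] by (auto simp: b_def)
    moreover have "M u w = M w u" using sym uv by simp
    ultimately show ?thesis using uv W by (metis insert_iff)
  qed
  ultimately show ?case by blast
qed

text \<open>Coordinate by coordinate the form is a sum of squares.\<close>

lemma psd_on_gram_matrix:
  assumes "\<And>v. v \<in> V \<Longrightarrow> a v \<in> carrier_vec n"
  shows "psd_on V (\<lambda>u v. a u \<bullet> a v)"
  unfolding psd_on_def
proof (intro conjI ballI allI)
  fix u v assume "u \<in> V" "v \<in> V"
  then show "a u \<bullet> a v = a v \<bullet> a u" using assms by (intro comm_scalar_prod)
next
  fix x :: "'a \<Rightarrow> real"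
  have "(\<Sum>u\<in>V. \<Sum>v\<in>V. x u * (a u \<bullet> a v) * x v) =
    (\<Sum>u\<in>V. \<Sum>v\<in>V. \<Sum>i<n. (x u * a u $ i) * (x v * a v $ i))"
    using assms
    by (intro sum.cong refl)
      (auto simp: scalar_prod_def sum_distrib_left sum_distrib_right lessThan_atLeast0 mult_ac
        dest: carrier_vecD[OF assms])
  also have "\<dots> = (\<Sum>i<n. (\<Sum>u\<in>V. x u * a u $ i)\<^sup>2)"
    unfolding power2_eq_square sum_product sum.swap[of _ V "{..<n}"]
    by (simp add: sum.swap[of _ V "{..<n}"])
  also have "\<dots> \<ge> 0" by (intro sum_nonneg) simp
  finally show "(\<Sum>u\<in>V. \<Sum>v\<in>V. x u * (a u \<bullet> a v) * x v) \<ge> 0" .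
qed

section \<open>Operations preserving positive semidefiniteness\<close>

lemma psd_on_add:
  assumes "psd_on V M" "psd_on V N"
  shows "psd_on V (\<lambda>u v. M u v + N u v)"
  using assms by (simp add: psd_on_def algebra_simps sum.distrib)

lemma psd_on_mult:
  assumes "psd_on V M" "c \<ge> 0"
  shows "psd_on V (\<lambda>u v. c * M u v)"
proof -
  have "(\<Sum>u\<in>V. \<Sum>v\<in>V. x u * (c * M u v) * x v) = c * (\<Sum>u\<in>V. \<Sum>v\<in>V. x u * M u v * x v)" for x
    by (simp add: sum_distrib_left mult_ac)
  then show ?thesis using assms by (simp add: psd_on_def)
qed

lemma psd_on_congruence:
  assumes "psd_on V M"
  shows "psd_on V (\<lambda>u v. d u * M u v * d v)"
proof -
  have "(\<Sum>u\<in>V. \<Sum>v\<in>V. x u * (d u * M u v * d v) * x v) =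
    (\<Sum>u\<in>V. \<Sum>v\<in>V. (x u * d u) * M u v * (x v * d v))" for x
    by (simp add: mult_ac)
  then show ?thesis using assms by (simp add: psd_on_def)
qed

text \<open>Restricts the form to test vectors \<open>x u * c s\<close>. For
  \<open>B = {1, - 1}\<close>, constant \<open>c\<close> selects the part symmetric under the sign
  flip, alternating \<open>c\<close> the antisymmetric part.\<close>

lemma psd_on_sum_fibres:
  assumes "psd_on (V \<times> B) M"
  shows "psd_on V (\<lambda>u v. \<Sum>s\<in>B. \<Sum>r\<in>B. c s * M (u, s) (v, r) * c r)"
  unfolding psd_on_def
proof (intro conjI ballI allI)
  fix u v assume "u \<in> V" "v \<in> V"
  then have "(\<Sum>s\<in>B. \<Sum>r\<in>B. c s * M (u, s) (v, r) * c r) = (\<Sum>s\<in>B. \<Sum>r\<in>B. c r * M (v, r) (u, s) * c s)"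
    using assms by (intro sum.cong refl) (auto simp: psd_on_def mult_ac)
  also have "\<dots> = (\<Sum>s\<in>B. \<Sum>r\<in>B. c s * M (v, s) (u, r) * c r)" by (rule sum.swap)
  finally show "(\<Sum>s\<in>B. \<Sum>r\<in>B. c s * M (u, s) (v, r) * c r) =
    (\<Sum>s\<in>B. \<Sum>r\<in>B. c s * M (v, s) (u, r) * c r)" .
next
  fix x :: "'a \<Rightarrow> real"
  define y where "y = (\<lambda>(u, s). x u * c s)"
  have "0 \<le> (\<Sum>p\<in>V \<times> B. \<Sum>q\<in>V \<times> B. y p * M p q * y q)" using assms unfolding psd_on_def by blast
  also have "\<dots> = (\<Sum>u\<in>V. \<Sum>s\<in>B. \<Sum>v\<in>V. \<Sum>r\<in>B. x u * (c s * M (u, s) (v, r) * c r) * x v)"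
    by (simp add: sum.cartesian_product' y_def mult_ac)
  also have "\<dots> = (\<Sum>u\<in>V. \<Sum>v\<in>V. \<Sum>s\<in>B. \<Sum>r\<in>B. x u * (c s * M (u, s) (v, r) * c r) * x v)"
    by (intro sum.cong refl sum.swap)
  also have "\<dots> = (\<Sum>u\<in>V. \<Sum>v\<in>V. x u * (\<Sum>s\<in>B. \<Sum>r\<in>B. c s * M (u, s) (v, r) * c r) * x v)"
    by (simp add: sum_distrib_left sum_distrib_right)
  finally show "0 \<le> \<dots>" .
qed

subsection \<open>Feasible matrices and maps into the sphere\<close>

definition theta_feasible :: "'a graph \<Rightarrow> real \<Rightarrow> bool" where
  "theta_feasible H l \<longleftrightarrow> (\<exists>M. psd_on (gverts H) M \<and> (\<forall>v\<in>gverts H. M v v = l - 1) \<and>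
     (\<forall>u v. {u, v} \<in> gedges H \<longrightarrow> M u v = - 1))"

definition balanced_feasible :: "'a sgraph \<Rightarrow> real \<Rightarrow> bool" where
  "balanced_feasible S t \<longleftrightarrow>
     t \<ge> 1 \<and> (\<exists>p q \<tau> f. signed_hom (completion S) (signed_sphere p q t) \<tau> f)"

text \<open>Guarantees that the infimum is over a nonempty set. The witness is n I - J, with n the
  number of vertices and J the all-ones matrix.\<close>

lemma theta_feasible_card:
  assumes "simple_graph H" "finite (gverts H)"
  shows "theta_feasible H (card (gverts H))"
proof -
  let ?V = "gverts H"
  let ?M = "\<lambda>u v. real (card ?V) * of_bool (u = v) - 1"
  have "(\<Sum>u\<in>?V. \<Sum>v\<in>?V. x u * ?M u v * x v) \<ge> 0" for x
  proof -
    have "(\<Sum>u\<in>?V. \<Sum>v\<in>?V. x u * ?M u v * x v) =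
      (\<Sum>u\<in>?V. \<Sum>v\<in>?V. card ?V * (x u * x v * of_bool (u = v))) - (\<Sum>u\<in>?V. \<Sum>v\<in>?V. x u * x v)"
      unfolding sum_subtractf[symmetric] by (intro sum.cong refl) (simp add: algebra_simps)
    also have "(\<Sum>u\<in>?V. \<Sum>v\<in>?V. card ?V * (x u * x v * of_bool (u = v))) =
        card ?V * (\<Sum>u\<in>?V. (x u)\<^sup>2)"
      using assms(2) by (simp add: sum_distrib_left power2_eq_square of_bool_def if_distrib cong: if_cong)
    also have "(\<Sum>u\<in>?V. \<Sum>v\<in>?V. x u * x v) = (\<Sum>u\<in>?V. x u)\<^sup>2"
      by (simp add: power2_eq_square sum_product)
    finally have eq: "(\<Sum>u\<in>?V. \<Sum>v\<in>?V. x u * ?M u v * x v) =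
      card ?V * (\<Sum>u\<in>?V. (x u)\<^sup>2) - (\<Sum>u\<in>?V. x u)\<^sup>2" .
    \<comment> \<open>Cauchy-Schwarz against the all-ones vector: the double sum of squared
      differences is twice the gap.\<close>
    have "(\<Sum>u\<in>?V. x u)\<^sup>2 \<le> card ?V * (\<Sum>u\<in>?V. (x u)\<^sup>2)"
    proof -
      have "0 \<le> (\<Sum>u\<in>?V. \<Sum>v\<in>?V. (x u - x v)\<^sup>2)" by (intro sum_nonneg) simp
      also have "\<dots> = 2 * (card ?V * (\<Sum>u\<in>?V. (x u)\<^sup>2)) - 2 * (\<Sum>u\<in>?V. x u)\<^sup>2"
        by (simp add: power2_diff sum.distrib sum_subtractf sum_distrib_left[symmetric]
            sum_distrib_right[symmetric] mult.assoc) (simp add: power2_eq_square)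
      finally show ?thesis by simp
    qed
    then show ?thesis unfolding eq by simp
  qed
  moreover have "?M u v = - 1" if "{u, v} \<in> gedges H" for u v
    using simple_graph.edge_two_ends[OF assms(1) that] by (auto simp: doubleton_eq_iff)
  ultimately show ?thesis
    unfolding theta_feasible_def psd_on_def by (intro exI[of _ ?M]) auto
qed

section \<open>Transfer between a signed graph and its conflict graph\<close>

context finite_signed_graph
begin

abbreviation C where "C \<equiv> conflict_graph S"

lemma completion_edge:
  assumes "({u, v}, \<sigma>) \<in> sedges (completion S)"
  shows "u \<in> sverts S" "v \<in> sverts S" "\<sigma> = 1 \<or> \<sigma> = - 1"
proof -
  interpret c: finite_signed_graph "completion S"
    by (rule finite_signed_graph_completion) unfold_locales
  show "u \<in> sverts S" "v \<in> sverts S"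
    using c.edge_ends[OF assms] by (auto simp: doubleton_eq_iff completion_def)
  show "\<sigma> = 1 \<or> \<sigma> = - 1" using c.edge_sign[OF assms] .
qed

lemma completion_loop: "v \<in> sverts S \<Longrightarrow> ({v, v}, 1) \<in> sedges (completion S)"
  by (simp add: completion_def)

lemma conflict_edge:
  assumes "({u, v}, \<sigma>) \<in> sedges (completion S)" "s = 1 \<or> s = - 1"
  shows "{(u, s), (v, - \<sigma> * s)} \<in> gedges C"
proof -
  have "- \<sigma> * s \<in> {1, - 1}" using completion_edge(3)[OF assms(1)] assms(2) by auto
  then show ?thesis using assms unfolding conflict_graph_def graph.simps by blast
qed

text \<open>Since \<open>\<sigma>\<close> is 1 or -1, the relation \<open>r = - \<sigma> * s\<close>
  is symmetric in \<open>r\<close> and \<open>s\<close>, so the unordered pair can be read in either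
  order with the same \<open>\<sigma>\<close>.\<close>

lemma conflict_edgeE:
  assumes "{(u, s), (v, r)} \<in> gedges C"
  obtains \<sigma> where "({u, v}, \<sigma>) \<in> sedges (completion S)" "s = 1 \<or> s = - 1" "r = - \<sigma> * s"
proof -
  obtain u' s' v' r' \<sigma> where e: "{(u, s), (v, r)} = {(u', s'), (v', r')}" "s' \<in> {1, - 1}"
    "r' \<in> {1, - 1}" "({u', v'}, \<sigma>) \<in> sedges (completion S)" "r' = - \<sigma> * s'"
    using assms unfolding conflict_graph_def graph.simps by blast
  have "({u, v}, \<sigma>) \<in> sedges (completion S)"
    using e by (auto simp: doubleton_eq_iff insert_commute)
  moreover have "s = 1 \<or> s = - 1" using e(1-3) by (auto simp: doubleton_eq_iff)
  moreover have "r = - \<sigma> * s" using e(1-3,5) completion_edge(3)[OF e(4)] by (auto simp: doubleton_eq_iff)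
  ultimately show thesis by (rule that)
qed

text \<open>The positive loop at a vertex joins its two copies, giving a 2 x 2 block with diagonal
  \<open>l - 1\<close> and off-diagonal -1; the test vector (1, 1) yields
  \<open>2 * (l - 1) - 2 \<ge> 0\<close>. This supplies the condition \<open>t \<ge> 1\<close> for
  \<open>t = l / 2\<close>.\<close>

lemma theta_feasible_ge_2:
  assumes "sverts S \<noteq> {}" "theta_feasible C l"
  shows "l \<ge> 2"
proof -
  obtain M where M: "psd_on (gverts C) M" "\<And>v. v \<in> gverts C \<Longrightarrow> M v v = l - 1"
    "\<And>u v. {u, v} \<in> gedges C \<Longrightarrow> M u v = - 1"
    using assms(2) by (auto simp: theta_feasible_def)
  obtain w where w: "w \<in> sverts S" using assms(1) by blast
  let ?G = "\<lambda>u v. \<Sum>s\<in>{1, - 1}. \<Sum>r\<in>{1, - 1}. 1 * M (u, s) (v, r) * 1"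
  have "psd_on (sverts S) ?G"
    using psd_on_sum_fibres[of "sverts S" "{1, - 1}" M "\<lambda>_. 1"] M(1) by (simp add: conflict_graph_def)
  \<comment> \<open>The Gram vectors serve to read off that the diagonal of \<open>?G\<close> is
    nonnegative.\<close>
  then obtain a where "\<forall>v\<in>sverts S. a v \<in> carrier_vec (card (sverts S))"
    "\<forall>u\<in>sverts S. \<forall>v\<in>sverts S. ?G u v = a u \<bullet> a v"
    using psd_on_gram[OF finite_verts] by blast
  then have "?G w w \<ge> 0" using w by (auto simp: scalar_prod_def intro: sum_nonneg)
  moreover have "M (w, 1) (w, - 1) = - 1" "M (w, - 1) (w, 1) = - 1"
    using conflict_edge[OF completion_loop[OF w], of 1]
      conflict_edge[OF completion_loop[OF w], of "- 1"] by (auto intro!: M(3))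
  moreover have "M (w, 1) (w, 1) = l - 1" "M (w, - 1) (w, - 1) = l - 1"
    using w by (auto intro!: M(2) simp: conflict_graph_def)
  ultimately show ?thesis by simp
qed

lemma theta_feasible_imp_balanced_feasible:
  assumes "t \<ge> 1" "theta_feasible C (2 * t)"
  shows "balanced_feasible S t"
proof -
  obtain M where psd: "psd_on (gverts C) M"
    and diag: "\<And>v. v \<in> gverts C \<Longrightarrow> M v v = 2 * t - 1"
    and edge: "\<And>u v. {u, v} \<in> gedges C \<Longrightarrow> M u v = - 1"
    using assms(2) by (auto simp: theta_feasible_def)
  \<comment> \<open>The inner products will be \<open>2 * k * P\<close> and
    \<open>2 * k * Q\<close>. Diagonal entries \<open>P v v = 2 * (2 * t - 1)\<close> must become 1,
    which fixes \<open>k\<close>; the edge value -2 then becomes \<open>gam t\<close>.\<close>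
  define k where "k = 1 / (4 * (2 * t - 1))"
  have k: "k > 0" "k * 4 = - gam t" "k * (2 * t - 1) = 1 / 4"
    using assms(1) by (auto simp: k_def gam_def field_simps)
  define P where "P u v = M (u, 1) (v, 1) + M (u, - 1) (v, - 1)" for u v
  define Q where "Q u v = M (u, 1) (v, - 1) + M (u, - 1) (v, 1)" for u v
  \<comment> \<open>The fibre coefficients are (1, \<open>\<epsilon>\<close>);
    \<open>\<epsilon> * \<epsilon> = 1\<close> leaves \<open>P + \<epsilon> Q\<close>.\<close>
  have gram: "\<exists>a. (\<forall>v\<in>sverts S. a v \<in> carrier_vec (card (sverts S))) \<and>
    (\<forall>u\<in>sverts S. \<forall>v\<in>sverts S. k * (P u v + \<epsilon> * Q u v) = a u \<bullet> a v)"
    if "\<epsilon> = 1 \<or> \<epsilon> = - 1" for \<epsilon>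
  proof (rule psd_on_gram[OF finite_verts])
    have "psd_on (sverts S) (\<lambda>u v. \<Sum>s\<in>{1, - 1}. \<Sum>r\<in>{1, - 1}.
        (if s = 1 then 1 else \<epsilon>) * M (u, s) (v, r) * (if r = 1 then 1 else \<epsilon>))"
      using psd by (intro psd_on_sum_fibres) (simp add: conflict_graph_def)
    also have "(\<lambda>u v. \<Sum>s\<in>{1, - 1}. \<Sum>r\<in>{1, - 1}.
        (if s = 1 then 1 else \<epsilon>) * M (u, s) (v, r) * (if r = 1 then 1 else \<epsilon>)) =
      (\<lambda>u v. P u v + \<epsilon> * Q u v)"
      using that by (auto simp: P_def Q_def fun_eq_iff)
    finally show "psd_on (sverts S) (\<lambda>u v. k * (P u v + \<epsilon> * Q u v))"
      using k(1) by (intro psd_on_mult) auto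
  qed
  obtain a where a: "\<And>v. v \<in> sverts S \<Longrightarrow> a v \<in> carrier_vec (card (sverts S))"
    "\<And>u v. u \<in> sverts S \<Longrightarrow> v \<in> sverts S \<Longrightarrow> a u \<bullet> a v = k * (P u v + Q u v)"
    using gram[of 1] by force
  obtain b where b: "\<And>v. v \<in> sverts S \<Longrightarrow> b v \<in> carrier_vec (card (sverts S))"
    "\<And>u v. u \<in> sverts S \<Longrightarrow> v \<in> sverts S \<Longrightarrow> b u \<bullet> b v = k * (P u v - Q u v)"
    using gram[of "- 1"] by force
  define f where "f v = (a v, b v)" for v
  let ?n = "card (sverts S)"
  have mem: "f v \<in> hspace ?n ?n" if "v \<in> sverts S" for v
    using that a(1) b(1) by (simp add: f_def hspace_def)
  have inner: "hinner (f u) (f v) = 2 * k * P u v"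
    and inner_refl: "hinner (f u) (hrefl (f v)) = 2 * k * Q u v"
    if "u \<in> sverts S" "v \<in> sverts S" for u v
    using hinner_hrefl[OF mem[OF that(1)] mem[OF that(2)]] a(2)[OF that] b(2)[OF that]
    by (simp_all add: hinner_def) (simp_all add: f_def algebra_simps)
  \<comment> \<open>A positive edge joins copies of opposite sign and so fixes both terms of
    \<open>Q\<close>; a negative edge joins copies of equal sign and fixes those of
    \<open>P\<close>. This symmetry lets the trivial switching suffice.\<close>
  have Q: "2 * k * Q u v = gam t" if "({u, v}, 1) \<in> sedges (completion S)" for u v
  proof -
    have "Q u v = - 2"
      using edge[OF conflict_edge[OF that, of 1]] edge[OF conflict_edge[OF that, of "- 1"]]
      by (simp add: Q_def)
    then show ?thesis using k(2) by simp
  qed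
  have P: "2 * k * P u v = gam t" if "({u, v}, - 1) \<in> sedges (completion S)" for u v
  proof -
    have "P u v = - 2"
      using edge[OF conflict_edge[OF that, of 1]] edge[OF conflict_edge[OF that, of "- 1"]]
      by (simp add: P_def)
    then show ?thesis using k(2) by simp
  qed
  have vert: "f v \<in> sphere_verts ?n ?n t" if v: "v \<in> sverts S" for v
  proof -
    have "P v v = 2 * (2 * t - 1)" using v by (simp add: P_def diag conflict_graph_def)
    then have "hinner (f v) (f v) = 4 * (k * (2 * t - 1))" using inner[OF v v] by (simp only: mult_ac)
    then have "hnorm (f v) = 1" using k(3) by (simp add: hnorm_def)
    \<comment> \<open>The positive loop at \<open>v\<close> yields the remaining sphere condition on
      \<open>hinner x (hrefl x)\<close>.\<close>
    then show ?thesis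
      using v mem Q[OF completion_loop[OF v]] by (simp add: sphere_verts_def inner_refl)
  qed
  have "signed_hom (completion S) (signed_sphere ?n ?n t) (\<lambda>_. 1) f"
    unfolding signed_hom_def
  proof (intro conjI allI impI)
    fix u v \<sigma> assume e: "({u, v}, \<sigma>) \<in> sedges (completion S)"
    note uv = completion_edge(1,2)[OF e]
    show "({f u, f v}, 1 * \<sigma> * 1) \<in> sedges (signed_sphere ?n ?n t)"
      using completion_edge(3)[OF e]
    proof
      assume "\<sigma> = 1"
      then show ?thesis using e uv
        by (simp add: signed_sphere_edge_iff vert inner_refl Q)
    next
      assume "\<sigma> = - 1"
      then show ?thesis using e uv
        by (simp add: signed_sphere_edge_iff vert inner P)
    qed
  qed (use vert in \<open>auto simp: completion_def signed_sphere_def\<close>)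
  then show ?thesis using assms(1) unfolding balanced_feasible_def by blast
qed

lemma balanced_feasible_imp_theta_feasible:
  assumes "balanced_feasible S t"
  shows "theta_feasible C (2 * t)"
proof -
  obtain p q \<tau> f where t: "t \<ge> 1"
    and hom: "signed_hom (completion S) (signed_sphere p q t) \<tau> f"
    using assms by (auto simp: balanced_feasible_def)
  have \<tau>: "\<tau> v = 1 \<or> \<tau> v = - 1" and vert: "f v \<in> sphere_verts p q t" if "v \<in> sverts S" for v
    using hom that by (auto simp: signed_hom_def completion_def signed_sphere_def)
  have mem: "f v \<in> hspace p q" if "v \<in> sverts S" for v
    using vert[OF that] by (simp add: sphere_verts_def)
  have comp: "fst (f v) \<in> carrier_vec p" "snd (f v) \<in> carrier_vec q" if "v \<in> sverts S" for v
    using mem[OF that] by (auto simp: hspace_def)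
  define A where "A x y = fst (f (fst x)) \<bullet> fst (f (fst y))" for x y :: "'a \<times> int"
  define B where "B x y = snd (f (fst x)) \<bullet> snd (f (fst y))" for x y :: "'a \<times> int"
  \<comment> \<open>The sign of the H- component: the vector attached to \<open>(v, s)\<close> is
    \<open>f v\<close> if \<open>\<tau> v * s = 1\<close> and its reflection otherwise.\<close>
  define d where "d x = real_of_int (\<tau> (fst x) * snd x)" for x
  \<comment> \<open>The factor turns squared norm 1 into \<open>2 * t - 1\<close> and
    \<open>gam t\<close> into -1.\<close>
  define M where "M x y = (2 * t - 1) * (A x y + d x * B x y * d y)" for x y
  have "psd_on (gverts C) A" unfolding A_def
    using comp(1) by (intro psd_on_gram_matrix[of _ _ p]) (auto simp: conflict_graph_def)
  moreover have "psd_on (gverts C) B" unfolding B_def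
    using comp(2) by (intro psd_on_gram_matrix[of _ _ q]) (auto simp: conflict_graph_def)
  ultimately have "psd_on (gverts C) M"
    unfolding M_def using t by (intro psd_on_mult psd_on_add psd_on_congruence) auto
  moreover have "M x x = 2 * t - 1" if mem_x: "x \<in> gverts C" for x
  proof -
    obtain v s where x: "x = (v, s)" "v \<in> sverts S" "s = 1 \<or> s = - 1"
      using mem_x unfolding conflict_graph_def graph.simps by blast
    have "M x x = (2 * t - 1) * hinner (f v) (f v)"
      using x \<tau>[OF x(2)] by (auto simp: M_def A_def B_def d_def hinner_def)
    then show ?thesis using vert[OF x(2)] by (simp add: sphere_verts_def hnorm_def)
  qed
  moreover have "M x y = - 1" if e: "{x, y} \<in> gedges C" for x y
  proof -
    obtain u s v r where xy: "x = (u, s)" "y = (v, r)" by fastforce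
    obtain \<sigma> where \<sigma>: "({u, v}, \<sigma>) \<in> sedges (completion S)" "s = 1 \<or> s = - 1" "r = - \<sigma> * s"
      using e unfolding xy by (rule conflict_edgeE)
    note uv = completion_edge(1,2)[OF \<sigma>(1)]
    let ?\<sigma> = "\<tau> u * \<sigma> * \<tau> v"
    \<comment> \<open>Here \<open>d x * d y = - ?\<sigma>\<close> because \<open>s * s = 1\<close>.
      Thus the bracket is the inner product with \<open>f v\<close> reflected exactly when the image
      edge is positive.\<close>
    have M: "M x y = (2 * t - 1) * (fst (f u) \<bullet> fst (f v) - ?\<sigma> * (snd (f u) \<bullet> snd (f v)))"
      using \<sigma>(2,3) by (auto simp: M_def A_def B_def d_def xy)
    have e': "({f u, f v}, ?\<sigma>) \<in> sedges (signed_sphere p q t)"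
      using hom \<sigma>(1) by (auto simp: signed_hom_def)
    have "?\<sigma> = 1 \<or> ?\<sigma> = - 1" using \<tau>[OF uv(1)] \<tau>[OF uv(2)] completion_edge(3)[OF \<sigma>(1)] by auto
    then have "fst (f u) \<bullet> fst (f v) - ?\<sigma> * (snd (f u) \<bullet> snd (f v)) = gam t"
    proof
      assume 1: "?\<sigma> = 1"
      show ?thesis
        using e' unfolding 1 signed_sphere_edge_iff(2)[OF vert vert, OF uv]
          hinner_hrefl[OF mem mem, OF uv] by simp
    next
      assume 1: "?\<sigma> = - 1"
      show ?thesis
        using e' unfolding 1 signed_sphere_edge_iff(1)[OF vert vert, OF uv] by (simp add: hinner_def)
    qed
    then show ?thesis using t unfolding M by (simp add: gam_def field_simps)
  qed
  ultimately show ?thesis unfolding theta_feasible_def by blast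
qed

end

theorem theorem6p1:
  fixes S :: "'a sgraph"
  assumes "finite_signed_graph S" and "sverts S \<noteq> {}"
  shows "balanced_theta S = 1 / 2 * theta_bar (conflict_graph S)"
proof -
  interpret finite_signed_graph S by fact
  let ?B = "Collect (balanced_feasible S)" and ?T = "Collect (theta_feasible C)"
  have ge: "2 \<le> l" if "theta_feasible C l" for l
    using theta_feasible_ge_2 assms(2) that .
  have T_B: "balanced_feasible S (l / 2)" if "theta_feasible C l" for l
    using theta_feasible_imp_balanced_feasible[of "l / 2"] ge[OF that] that by simp
  have "finite (gverts C)" using finite_verts by (simp add: conflict_graph_def)
  then have T: "?T \<noteq> {}"
    using theta_feasible_card[OF simple_graph_conflict_graph[OF assms(1)]] by blast
  have bdd: "bdd_below ?T" "bdd_below ?B"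
    using ge by (auto simp: bdd_below_def balanced_feasible_def)
  \<comment> \<open>Halving maps \<open>?T\<close> into \<open>?B\<close> and doubling maps
    \<open>?B\<close> into \<open>?T\<close>; both sets are nonempty and bounded below, so each
    bound on elements passes to the infima.\<close>
  have "Inf ?B = Inf ?T / 2"
  proof (rule antisym)
    have "2 * Inf ?B \<le> l" if "l \<in> ?T" for l
      using cInf_lower[of "l / 2" ?B] bdd(2) T_B that by simp
    then show "Inf ?B \<le> Inf ?T / 2" using cInf_greatest[OF T, of "2 * Inf ?B"] by simp
    have "Inf ?T / 2 \<le> t" if "t \<in> ?B" for t
      using cInf_lower[of "2 * t" ?T] bdd(1) balanced_feasible_imp_theta_feasible that by simp
    moreover have "?B \<noteq> {}" using T T_B by blast
    ultimately show "Inf ?T / 2 \<le> Inf ?B" by (intro cInf_greatest)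
  qed
  then show ?thesis
    unfolding balanced_theta_def theta_bar_def balanced_feasible_def theta_feasible_def by simp
qed

end
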